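(* For every integer $n\ge 3$, the cycle matroid $M(K_n)$ of the complete graph $K_n$ satisfies $$\max\{T_{M(K_n)}(2,0),\,T_{M(K_n)}(0,2)\}\ \ge\ T_{M(K_n)}(1,1).$$
   Context: For a matroid $M=(E,r)$, $T_M(x,y)=\sum_{A\subseteq E}(x-1)^{r(E)-r(A)}(y-1)^{|A|-r(A)}$ is the Tutte polynomial. For a connected graph $G$, $T_{M(G)}(2,0)$, $T_{M(G)}(0,2)$ and $T_{M(G)}(1,1)$ are the numbers of acyclic orientations (no directed cycle), totally cyclic orientations (every edge lies in a directed cycle) and spanning trees of $G$, respectively. *)

theory Defs
  imports Complex_Main "HOL-Number_Theory.Cong"
begin

section \<open>Matroids and the Tutte polynomial\<close>

text \<open>
  A matroid is given, as in \<open>M = (E, r)\<close>, by its ground set and its rank function. Only the values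
  of the rank function on subsets of the ground set matter.
\<close>

type_synonym 'e matroid = "'e set \<times> ('e set \<Rightarrow> nat)"

abbreviation ground :: "'e matroid \<Rightarrow> 'e set" where "ground \<equiv> fst"
abbreviation rank :: "'e matroid \<Rightarrow> 'e set \<Rightarrow> nat" where "rank \<equiv> snd"

locale matroid =
  fixes M :: "'e matroid"
  assumes finite_ground: "finite (ground M)"
    and rank_le_card: "A \<subseteq> ground M \<Longrightarrow> rank M A \<le> card A"
    and rank_mono: "A \<subseteq> B \<Longrightarrow> B \<subseteq> ground M \<Longrightarrow> rank M A \<le> rank M B"
    and rank_submodular: "A \<subseteq> ground M \<Longrightarrow> B \<subseteq> ground M \<Longrightarrow>
      rank M (A \<union> B) + rank M (A \<inter> B) \<le> rank M A + rank M B"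

text \<open>
  The two subtractions on natural numbers do not truncate when \<open>M\<close> is a matroid, by \<open>rank_mono\<close> and
  \<open>rank_le_card\<close>. As in the usual convention, \<open>0 ^ 0 = 1\<close>.
\<close>

definition tutte :: "'e matroid \<Rightarrow> 'a::comm_ring_1 \<Rightarrow> 'a \<Rightarrow> 'a" where
  "tutte M x y = (\<Sum>A\<in>Pow (ground M).
     (x - 1) ^ (rank M (ground M) - rank M A) * (y - 1) ^ (card A - rank M A))"

section \<open>Cycle matroids of simple graphs\<close>

text \<open>A simple graph is a pair of a vertex set and a set of two-element sets of vertices.\<close>

type_synonym 'v graph = "'v set \<times> 'v set set"

abbreviation verts :: "'v graph \<Rightarrow> 'v set" where "verts \<equiv> fst"
abbreviation edges :: "'v graph \<Rightarrow> 'v set set" where "edges \<equiv> snd"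

definition finite_simple_graph :: "'v graph \<Rightarrow> bool" where
  "finite_simple_graph G \<longleftrightarrow> finite (verts G) \<and> (\<forall>e\<in>edges G. e \<subseteq> verts G \<and> card e = 2)"

definition complete_graph :: "nat \<Rightarrow> nat graph" where
  "complete_graph n = ({1..n}, {e. e \<subseteq> {1..n} \<and> card e = 2})"

text \<open>The edge set of the cycle running through the listed vertices and back to the first one.\<close>

definition cycle_edges :: "'v list \<Rightarrow> 'v set set" where
  "cycle_edges vs = {{vs ! i, vs ! (Suc i mod length vs)} |i. i < length vs}"

definition forest :: "'v set set \<Rightarrow> bool" where
  "forest F \<longleftrightarrow> \<not> (\<exists>vs. distinct vs \<and> 3 \<le> length vs \<and> cycle_edges vs \<subseteq> F)"

text \<open>
  The independent sets of the cycle matroid are the forests, so the rank of a set of edges is the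
  largest size of a forest contained in it.
\<close>

definition cycle_matroid :: "'v graph \<Rightarrow> 'v set matroid" where
  "cycle_matroid G = (edges G, \<lambda>A. Max {card F |F. F \<subseteq> A \<and> forest F})"

section \<open>The cycle matroid is a matroid\<close>

definition reach :: "'v set set \<Rightarrow> ('v \<times> 'v) set" where
  "reach F = {(u, v). {u, v} \<in> F}\<^sup>*"

lemma reach_sym: "(u, v) \<in> reach F \<Longrightarrow> (v, u) \<in> reach F"
proof -
  have "sym {(u, v). {u, v} \<in> F}" by (auto simp: sym_def insert_commute)
  then show "(u, v) \<in> reach F \<Longrightarrow> (v, u) \<in> reach F"
    unfolding reach_def by (meson sym_rtrancl symD)
qed

lemma reach_trans: "(u, v) \<in> reach F \<Longrightarrow> (v, w) \<in> reach F \<Longrightarrow> (u, w) \<in> reach F"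
  unfolding reach_def by simp

lemma reach_edge: "{u, v} \<in> F \<Longrightarrow> (u, v) \<in> reach F"
  unfolding reach_def by auto

lemma reach_refl: "(u, u) \<in> reach F"
  unfolding reach_def by simp

lemma forest_mono: "forest F \<Longrightarrow> F' \<subseteq> F \<Longrightarrow> forest F'"
  unfolding forest_def by blast

lemma cycle_edges_nonempty: "3 \<le> length vs \<Longrightarrow> cycle_edges vs \<noteq> {}"
proof -
  assume "3 \<le> length vs"
  then have "{vs ! 0, vs ! (Suc 0 mod length vs)} \<in> cycle_edges vs"
    unfolding cycle_edges_def by (intro CollectI exI[of _ 0]) auto
  then show ?thesis by blast
qed

lemma forest_empty: "forest {}"
  unfolding forest_def using cycle_edges_nonempty by auto

lemma reach_path:
  assumes "(a, b) \<in> reach F"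
  shows "\<exists>p. p \<noteq> [] \<and> hd p = a \<and> last p = b \<and> distinct p \<and> successively (\<lambda>u v. {u, v} \<in> F) p"
  using assms unfolding reach_def
proof (induction rule: converse_rtrancl_induct)
  case base
  show ?case by (rule exI[of _ "[b]"]) auto
next
  case (step a y)
  then obtain p where p: "p \<noteq> []" "hd p = y" "last p = b" "distinct p"
    "successively (\<lambda>u v. {u, v} \<in> F) p" by blast
  show ?case
  proof (cases "a \<in> set p")
    case True
    then obtain q r where "p = q @ a # r" by (meson split_list)
    with p show ?thesis
      by (intro exI[of _ "a # r"]) (auto simp: successively_append_iff)
  next
    case False
    with p step show ?thesis
      by (intro exI[of _ "a # p"]) (auto simp: successively_Cons)
  qed
qed

lemma forest_insertD:
  assumes f: "forest (insert {a, b} F)" and "{a, b} \<notin> F" "a \<noteq> b"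
  shows "(a, b) \<notin> reach F"
proof
  assume "(a, b) \<in> reach F"
  from reach_path[OF this] obtain p where p: "p \<noteq> []" "hd p = a" "last p = b" "distinct p"
    "successively (\<lambda>u v. {u, v} \<in> F) p" by blast
  have len: "3 \<le> length p"
  proof (rule ccontr)
    assume "\<not> 3 \<le> length p"
    moreover have "length p \<noteq> 0" using p(1) by simp
    ultimately consider x where "p = [x]" | x y where "p = [x, y]"
      by (cases p; cases "tl p"; cases "tl (tl p)") auto
    then show False using p(2,3,5) assms(2,3) by cases auto
  qed
  have "cycle_edges p \<subseteq> insert {a, b} F"
  proof
    fix e assume "e \<in> cycle_edges p"
    then obtain i where i: "i < length p" "e = {p ! i, p ! (Suc i mod length p)}"
      unfolding cycle_edges_def by blast
    show "e \<in> insert {a, b} F"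
    proof (cases "Suc i < length p")
      case True
      then show ?thesis using p(5) i by (auto simp: successively_conv_nth)
    next
      case False
      with i have "Suc i = length p" by simp
      moreover from this have "i = length p - 1" by simp
      ultimately show ?thesis using i p by (auto simp: hd_conv_nth last_conv_nth)
    qed
  qed
  with f p(4) len show False unfolding forest_def by blast
qed

lemma forest_insertI:
  assumes f: "forest F" and nr: "(c, d) \<notin> reach F"
  shows "forest (insert {c, d} F)"
  unfolding forest_def
proof
  assume "\<exists>vs. distinct vs \<and> 3 \<le> length vs \<and> cycle_edges vs \<subseteq> insert {c, d} F"
  then obtain vs where vs: "distinct vs" "3 \<le> length vs" "cycle_edges vs \<subseteq> insert {c, d} F"
    by blast
  let ?k = "length vs"
  let ?v = "\<lambda>j. vs ! (j mod ?k)"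
  have E: "{?v j, ?v (Suc j)} \<in> insert {c, d} F" for j
  proof -
    have "j mod ?k < ?k" using vs(2) by (intro mod_less_divisor) auto
    then have "{vs ! (j mod ?k), vs ! (Suc (j mod ?k) mod ?k)} \<in> cycle_edges vs"
      unfolding cycle_edges_def by blast
    then show ?thesis using vs(3) by (auto simp: mod_Suc_eq)
  qed
  from f vs have "\<not> cycle_edges vs \<subseteq> F" unfolding forest_def by blast
  then have "{c, d} \<in> cycle_edges vs" using vs(3) by blast
  then obtain i where i: "i < ?k" "{c, d} = {vs ! i, vs ! (Suc i mod ?k)}"
    unfolding cycle_edges_def by blast
  then have i2: "{?v i, ?v (Suc i)} = {c, d}" by simp
  have inj: "?v x = ?v y \<longleftrightarrow> x mod ?k = y mod ?k" for x y
  proof -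
    have "x mod ?k < ?k" "y mod ?k < ?k" using vs(2) by (auto intro!: mod_less_divisor)
    then show ?thesis using nth_eq_iff_index_eq[OF vs(1)] by blast
  qed
  have step: "(?v (i + j), ?v (Suc (i + j))) \<in> reach F" if j: "1 \<le> j" "j < ?k" for j
  proof -
    have "{?v (i + j), ?v (Suc (i + j))} \<noteq> {?v i, ?v (Suc i)}"
    proof
      assume "{?v (i + j), ?v (Suc (i + j))} = {?v i, ?v (Suc i)}"
      then consider "?v (i + j) = ?v (i + 0)"
        | "?v (i + j) = ?v (i + 1)" "?v (i + (j + 1)) = ?v (i + 0)"
        by (auto simp: doubleton_eq_iff)
      then show False
      proof cases
        case 1
        then have "[i + j = i + 0] (mod ?k)" unfolding inj cong_def by simp
        then have "[j = 0] (mod ?k)" by (simp only: cong_add_lcancel_nat)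
        then show False using j by (simp add: cong_def)
      next
        case 2
        from 2 have "[i + j = i + 1] (mod ?k)" "[i + (j + 1) = i + 0] (mod ?k)"
          unfolding inj cong_def by simp_all
        then have "[j = 1] (mod ?k)" "[j + 1 = 0] (mod ?k)"
          by (simp_all only: cong_add_lcancel_nat)
        then have "j = 1" "(j + 1) mod ?k = 0" using j vs(2) by (simp_all add: cong_def)
        then show False using vs(2) by simp
      qed
    qed
    then show ?thesis using E[of "i + j"] i2 by (auto intro: reach_edge)
  qed
  have walk: "(?v (Suc i), ?v (i + Suc j)) \<in> reach F" if "Suc j \<le> ?k" for j
    using that
  proof (induction j)
    case 0
    show ?case by (simp add: reach_refl)
  next
    case (Suc j)
    then show ?case using step[of "Suc j"] reach_trans by fastforce
  qed
  have "(?v (Suc i), ?v i) \<in> reach F"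
  proof -
    have "Suc (?k - 1) = ?k" using vs(2) by linarith
    then show ?thesis using walk[of "?k - 1"] by (simp del: add_Suc_right)
  qed
  then have "(c, d) \<in> reach F" using i2 reach_sym by (auto simp: doubleton_eq_iff)
  with nr show False by contradiction
qed

lemma reach_crossing:
  assumes "(a, b) \<in> reach I" "(a, b) \<notin> reach F"
  shows "\<exists>c d. {c, d} \<in> I \<and> (a, c) \<in> reach F \<and> (a, d) \<notin> reach F"
  using assms(1) assms(2) unfolding reach_def[of I]
proof (induction rule: rtrancl_induct)
  case base
  then show ?case by (simp add: reach_refl)
next
  case (step y z)
  then show ?case by blast
qed

lemma forest_card_le:
  assumes "finite I" "finite J" "forest J" "\<forall>e\<in>I \<union> J. card e = 2"
    and "\<And>u v. {u, v} \<in> J \<Longrightarrow> (u, v) \<in> reach I"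
  shows "card J \<le> card I"
  using assms
proof (induction "card (J - I)" arbitrary: J)
  case 0
  then have "J \<subseteq> I" by simp
  with 0 show ?case by (simp add: card_mono)
next
  case (Suc n)
  then have "J - I \<noteq> {}" by (metis card.empty nat.distinct(1))
  then obtain e where e: "e \<in> J" "e \<notin> I" by blast
  with Suc.prems(4) have "card e = 2" by blast
  then obtain a b where ab: "e = {a, b}" "a \<noteq> b" by (meson card_2_iff)
  let ?F = "J - {e}"
  have "forest (insert {a, b} ?F)" using Suc.prems(3) e ab by (simp add: insert_absorb)
  with ab have nr: "(a, b) \<notin> reach ?F" by (intro forest_insertD) auto
  have "(a, b) \<in> reach I" using Suc.prems(5) e ab by simp
  from reach_crossing[OF this nr] obtain c d where
    cd: "{c, d} \<in> I" "(a, c) \<in> reach ?F" "(a, d) \<notin> reach ?F" by blast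
  have nr': "(c, d) \<notin> reach ?F" using cd reach_trans by metis
  then have notF: "{c, d} \<notin> ?F" using reach_edge by metis
  then have notJ: "{c, d} \<notin> J" using cd(1) e by auto
  let ?J = "insert {c, d} ?F"
  have "?J - I = (J - I) - {e}" using cd(1) by auto
  then have n: "n = card (?J - I)" using Suc.hyps(2) Suc.prems(2) e by simp
  have fJ: "forest ?J" using forest_mono[OF Suc.prems(3)] nr' by (intro forest_insertI) auto
  have "card ?J \<le> card I"
  proof (rule Suc.hyps(1)[OF n])
    show "finite I" "finite ?J" "\<forall>e\<in>I \<union> ?J. card e = 2" using Suc.prems cd by auto
    show "forest ?J" by (rule fJ)
    show "(u, v) \<in> reach I" if uv: "{u, v} \<in> ?J" for u v
    proof (cases "{u, v} = {c, d}")
      case True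
      then show ?thesis using cd(1) reach_edge by metis
    next
      case False
      then show ?thesis using uv Suc.prems(5) by auto
    qed
  qed
  moreover have "card ?J = Suc (card ?F)" using notF Suc.prems(2)
    by (intro card_insert_disjoint) auto
  moreover have "card J = Suc (card ?F)" using Suc.prems(2) e(1) by (rule card.remove)
  ultimately show ?case by simp
qed

lemma forest_augment:
  assumes "finite I" "finite J" "forest I" "forest J" "\<forall>e\<in>I \<union> J. card e = 2" "card I < card J"
  shows "\<exists>e\<in>J - I. forest (insert e I)"
proof -
  from forest_card_le[of I J] assms obtain u v where uv: "{u, v} \<in> J" "(u, v) \<notin> reach I"
    by (metis linorder_not_le)
  then have "{u, v} \<notin> I" using reach_edge by metis
  with uv assms(3) show ?thesis using forest_insertI by fastforce
qed

abbreviation (input) forest_sizes :: "'v set set \<Rightarrow> nat set" where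
  "forest_sizes A \<equiv> {card F |F. F \<subseteq> A \<and> forest F}"

lemma finite_forest_sizes:
  assumes "finite A"
  shows "finite (forest_sizes A)"
proof (rule finite_subset)
  show "forest_sizes A \<subseteq> card ` Pow A" by blast
  show "finite (card ` Pow A)" using assms by simp
qed

lemma card_le_rank:
  assumes "finite A" "F \<subseteq> A" "forest F"
  shows "card F \<le> Max (forest_sizes A)"
proof (rule Max_ge)
  show "finite (forest_sizes A)" by (rule finite_forest_sizes[OF assms(1)])
  show "card F \<in> forest_sizes A" using assms(2,3) by blast
qed

lemma rank_attained:
  assumes "finite A"
  shows "\<exists>F. F \<subseteq> A \<and> forest F \<and> card F = Max (forest_sizes A)"
proof -
  have "forest_sizes A \<noteq> {}" using forest_empty by blast
  then have "Max (forest_sizes A) \<in> forest_sizes A"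
    by (intro Max_in finite_forest_sizes assms)
  then obtain F where "Max (forest_sizes A) = card F" "F \<subseteq> A" "forest F" by blast
  then show ?thesis by (intro exI[of _ F]) simp
qed

lemma forest_extend:
  assumes "finite A" "I \<subseteq> A" "forest I" "\<forall>e\<in>A. card e = 2"
  shows "\<exists>J. I \<subseteq> J \<and> J \<subseteq> A \<and> forest J \<and> card J = Max (forest_sizes A)"
  using assms(2,3)
proof (induction "Max (forest_sizes A) - card I" arbitrary: I)
  case 0
  then show ?case using card_le_rank[OF assms(1) 0(2,3)] by auto
next
  case (Suc n)
  obtain L where L: "L \<subseteq> A" "forest L" "card L = Max (forest_sizes A)"
    using rank_attained[OF assms(1)] by blast
  have fin: "finite I" "finite L" using Suc.prems L assms(1) finite_subset by auto
  have lt: "card I < card L" using Suc.hyps(2) L(3) by simp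
  obtain e where e: "e \<in> L - I" "forest (insert e I)"
    using forest_augment[OF fin Suc.prems(2) L(2) _ lt] assms(4) L(1) Suc.prems(1) by blast
  have n: "n = Max (forest_sizes A) - card (insert e I)" using Suc.hyps(2) e fin by simp
  have sub: "insert e I \<subseteq> A" using e(1) L(1) Suc.prems(1) by blast
  from Suc.hyps(1)[OF n sub e(2)] show ?case by (elim ex_forward) simp
qed

theorem matroid_cycle_matroid:
  assumes "finite_simple_graph G"
  shows "matroid (cycle_matroid G)"
proof
  have two: "\<forall>e\<in>edges G. card e = 2" and fin: "finite (edges G)"
    using assms finite_subset[of "edges G" "Pow (verts G)"]
    unfolding finite_simple_graph_def by auto
  show "finite (ground (cycle_matroid G))" using fin by (simp add: cycle_matroid_def)
  fix A assume A: "A \<subseteq> ground (cycle_matroid G)"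
  then have finA: "finite A" using fin finite_subset by (auto simp: cycle_matroid_def)
  show "rank (cycle_matroid G) A \<le> card A"
  proof -
    obtain F where F: "F \<subseteq> A" "card F = Max (forest_sizes A)"
      using rank_attained[OF finA] by blast
    show ?thesis using card_mono[OF finA F(1)] unfolding F(2) by (simp add: cycle_matroid_def)
  qed
  fix B assume B: "B \<subseteq> ground (cycle_matroid G)"
  then have finB: "finite B" using fin finite_subset by (auto simp: cycle_matroid_def)
  have finU: "finite (A \<union> B)" and finI: "finite (A \<inter> B)" using finA finB by auto
  obtain I where I: "I \<subseteq> A \<inter> B" "forest I" "card I = Max (forest_sizes (A \<inter> B))"
    using rank_attained[OF finI] by blast
  have sub: "I \<subseteq> A \<union> B" and two': "\<forall>e\<in>A \<union> B. card e = 2"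
    using I(1) two A B by (auto simp: cycle_matroid_def)
  obtain J where J: "I \<subseteq> J" "J \<subseteq> A \<union> B" "forest J" "card J = Max (forest_sizes (A \<union> B))"
    using forest_extend[OF finU sub I(2) two'] by blast
  have finJ: "finite J" using J finU finite_subset by blast
  have "card I \<le> card (J \<inter> A \<inter> (J \<inter> B))" using I J finJ by (intro card_mono) auto
  moreover have "card (J \<inter> A) + card (J \<inter> B) = card J + card (J \<inter> A \<inter> (J \<inter> B))"
    using card_Un_Int[of "J \<inter> A" "J \<inter> B"] finJ J(2)
    by (metis Int_Un_distrib finite_Int inf.absorb1)
  moreover have "card (J \<inter> A) \<le> Max (forest_sizes A)" "card (J \<inter> B) \<le> Max (forest_sizes B)"
    by (intro card_le_rank finA finB Int_lower2 forest_mono[OF J(3)] Int_lower1)+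
  ultimately show "rank (cycle_matroid G) (A \<union> B) + rank (cycle_matroid G) (A \<inter> B)
    \<le> rank (cycle_matroid G) A + rank (cycle_matroid G) B"
    using I(3) J(4) by (simp add: cycle_matroid_def)
next
  fix A B assume AB: "A \<subseteq> B" "B \<subseteq> ground (cycle_matroid G)"
  have "finite (edges G)"
    using assms finite_subset[of "edges G" "Pow (verts G)"]
    unfolding finite_simple_graph_def by auto
  then have "finite B" using AB(2) finite_subset by (auto simp: cycle_matroid_def)
  then have fin: "finite B" "finite A" using finite_subset[OF AB(1)] by blast+
  from rank_attained[OF fin(2)] obtain F where
    "F \<subseteq> A" "forest F" "card F = Max (forest_sizes A)" by blast
  then show "rank (cycle_matroid G) A \<le> rank (cycle_matroid G) B"
    using card_le_rank[OF fin(1), of F] AB(1) by (auto simp: cycle_matroid_def)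
qed

lemma finite_simple_graph_complete_graph: "finite_simple_graph (complete_graph n)"
  by (auto simp: finite_simple_graph_def complete_graph_def)

end

theory Submission
  imports Defs
begin

text \<open>
  Split an edge set of \<open>K\<^bsub>n+1\<^esub>\<close> into an edge set \<open>A\<close> of \<open>K\<^sub>n\<close> and the set \<open>S\<close> of neighbours of the last
  vertex. Its rank is \<open>r(A)\<close> plus the number of components of \<open>A\<close> that \<open>S\<close> meets, so the sum over \<open>S\<close>
  factors over the components and \<open>T(x, 2) = \<Sum>\<^bsub>A\<^esub> \<Prod>\<^bsub>b\<^esub> (2\<^bsup>|b|\<^esup> + x - 2)\<close>, where \<open>b\<close> ranges over the components
  of \<open>A\<close>. For \<open>x = 0\<close> and \<open>x = 1\<close> all terms are nonnegative. Keeping only the connected \<open>A\<close>, whose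
  number is \<open>c\<^sub>n\<close>, bounds \<open>T(0, 2)\<close> below by \<open>(2\<^sup>n - 2) c\<^sub>n\<close>; the term of the empty \<open>A\<close> gives in addition
  \<open>c\<^bsub>n+1\<^esub> \<ge> (2\<^sup>n - 1) c\<^sub>n + 1\<close>. The trivial bound by the number of \<open>n\<close>-element edge sets is enough for the
  spanning trees, except on \<open>K\<^sub>3\<close>, where \<open>T(2, 0) = 6\<close>.
\<close>

section \<open>Sums over subsets, factored along the fibres of a map\<close>

lemma sum_Pow_Un_disjoint:
  assumes "A \<inter> B = {}"
  shows "(\<Sum>X\<in>Pow (A \<union> B). g X) = (\<Sum>X\<in>Pow A. \<Sum>Y\<in>Pow B. g (X \<union> Y))"
proof -
  have "(\<Sum>X\<in>Pow A. \<Sum>Y\<in>Pow B. g (X \<union> Y)) = (\<Sum>(X, Y)\<in>Pow A \<times> Pow B. g (X \<union> Y))"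
    by (rule sum.cartesian_product)
  also have "\<dots> = (\<Sum>X\<in>Pow (A \<union> B). g X)"
    using assms
    by (intro sum.reindex_bij_witness[where i = "\<lambda>X. (X \<inter> A, X \<inter> B)" and j = "\<lambda>(X, Y). X \<union> Y"]) auto
  finally show ?thesis ..
qed

lemma sum_Pow_empty_indicator:
  fixes x :: "'a::comm_ring_1"
  assumes "finite A"
  shows "(\<Sum>T\<in>Pow A. if T = {} then x else 1) = x + 2 ^ card A - 1"
proof -
  have "(\<Sum>T\<in>Pow A. if T = {} then x else 1) = x + (\<Sum>T\<in>Pow A - {{}}. 1)"
    using assms by (subst sum.remove[of _ "{}"]) (auto intro!: sum.cong)
  also have "(\<Sum>T\<in>Pow A - {{}}. 1 :: 'a) = of_nat (2 ^ card A - 1)"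
    using assms by (simp add: card_Diff_subset card_Pow)
  finally show ?thesis by (simp add: of_nat_diff)
qed

text \<open>A set S amounts to an independent choice of a subset of each fibre of \<open>f\<close>.
  The empty choice leaves the value \<open>b\<close> missed and has weight \<open>x\<close>; each of
  the 2^k - 1 nonempty choices in a fibre of size k has weight 1.\<close>

lemma sum_Pow_power_missed_values:
  fixes x :: "'a::comm_ring_1"
  assumes "finite V" "finite B"
  shows "(\<Sum>S\<in>Pow {v \<in> V. f v \<in> B}. x ^ card (B - f ` S))
    = (\<Prod>b\<in>B. x + 2 ^ card {v \<in> V. f v = b} - 1)"
  using assms(2)
proof induction
  case empty
  show ?case by simp
next
  case (insert b B)
  let ?W = "{v \<in> V. f v \<in> B}" and ?F = "{v \<in> V. f v = b}"
  have "{v \<in> V. f v \<in> insert b B} = ?W \<union> ?F" "?W \<inter> ?F = {}" using insert.hyps by auto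
  then have "(\<Sum>S\<in>Pow {v \<in> V. f v \<in> insert b B}. x ^ card (insert b B - f ` S))
    = (\<Sum>S\<in>Pow ?W. \<Sum>T\<in>Pow ?F. x ^ card (insert b B - f ` (S \<union> T)))"
    by (simp only: sum_Pow_Un_disjoint)
  also have "\<dots> = (\<Sum>S\<in>Pow ?W. \<Sum>T\<in>Pow ?F. x ^ card (B - f ` S) * (if T = {} then x else 1))"
  proof (intro sum.cong refl)
    fix S T assume ST: "S \<in> Pow ?W" "T \<in> Pow ?F"
    show "x ^ card (insert b B - f ` (S \<union> T)) = x ^ card (B - f ` S) * (if T = {} then x else 1)"
    proof (cases "T = {}")
      case True
      have "insert b B - f ` (S \<union> T) = insert b (B - f ` S)" using True ST insert.hyps by auto
      then show ?thesis using True insert.hyps by simp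
    next
      case False
      then have "insert b B - f ` (S \<union> T) = B - f ` S" using ST insert.hyps by auto
      then show ?thesis using False by simp
    qed
  qed
  also have "\<dots> = (\<Sum>S\<in>Pow ?W. x ^ card (B - f ` S)) * (\<Sum>T\<in>Pow ?F. if T = {} then x else 1)"
    by (simp only: sum_product)
  also have "\<dots> = (\<Prod>b\<in>insert b B. x + 2 ^ card {v \<in> V. f v = b} - 1)"
    using insert assms(1) by (simp add: sum_Pow_empty_indicator mult.commute)
  finally show ?case .
qed

section \<open>Ranks of edge sets\<close>

abbreviation (input) forest_rank :: "'v set set \<Rightarrow> nat" where
  "forest_rank A \<equiv> Max (forest_sizes A)"

lemma reach_mono: "A \<subseteq> B \<Longrightarrow> reach A \<subseteq> reach B"
  unfolding reach_def by (intro rtrancl_mono) auto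

lemma reach_subsetI:
  assumes "\<And>u v. {u, v} \<in> A \<Longrightarrow> (u, v) \<in> reach B"
  shows "reach A \<subseteq> reach B"
  using assms unfolding reach_def by (intro rtrancl_subset_rtrancl) auto

text \<open>An edge of \<open>A\<close> between vertices that \<open>F\<close> does not connect
  would extend \<open>F\<close> to a larger forest in \<open>A\<close>.\<close>

lemma reach_maximum_forest:
  assumes "finite A" "F \<subseteq> A" "forest F" "card F = forest_rank A"
  shows "reach F = reach A"
proof
  show "reach F \<subseteq> reach A" using assms(2) by (rule reach_mono)
  show "reach A \<subseteq> reach F"
  proof (rule reach_subsetI, rule ccontr)
    fix u v assume uv: "{u, v} \<in> A" "(u, v) \<notin> reach F"
    then have "{u, v} \<notin> F" using reach_edge by metis
    moreover have "card (insert {u, v} F) \<le> forest_rank A"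
      using uv assms by (intro card_le_rank forest_insertI) auto
    moreover have "finite F" using assms(1,2) by (rule finite_subset[rotated])
    ultimately show False using assms(4) by simp
  qed
qed

text \<open>A maximum forest of \<open>A\<close> already connects the ends of every edge of
  \<open>B\<close>, so by the exchange argument in \<open>forest_card_le\<close> no forest of
  \<open>B\<close> is larger.\<close>

lemma rank_eq_of_reach:
  assumes "finite B" "A \<subseteq> B" "\<forall>e\<in>B. card e = 2" "\<And>u v. {u, v} \<in> B \<Longrightarrow> (u, v) \<in> reach A"
  shows "forest_rank B = forest_rank A"
proof (rule antisym)
  have fin: "finite A" using assms(1,2) by (rule finite_subset[rotated])
  obtain I where I: "I \<subseteq> A" "forest I" "card I = forest_rank A" using rank_attained[OF fin] by blast
  obtain J where J: "J \<subseteq> B" "forest J" "card J = forest_rank B" using rank_attained[OF assms(1)] by blast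
  have "card J \<le> card I"
  proof (rule forest_card_le)
    show "finite I" "finite J" using I J fin assms(1) by (auto intro: finite_subset)
    show "\<forall>e\<in>I \<union> J. card e = 2" using I J assms(2,3) by blast
    show "(u, v) \<in> reach I" if "{u, v} \<in> J" for u v
      using reach_maximum_forest[OF fin I] assms(4) J(1) that by blast
  qed (fact J(2))
  then show "forest_rank B \<le> forest_rank A" using I J by simp
  show "forest_rank A \<le> forest_rank B" using card_le_rank[OF assms(1), of I] I assms(2) by auto
qed

text \<open>The new edge extends a maximum forest of \<open>A\<close>; conversely, deleting it from
  a forest of the larger set leaves a forest in \<open>A\<close>.\<close>

lemma rank_insert_unreachable:
  assumes "finite A" "(c, d) \<notin> reach A"
  shows "forest_rank (insert {c, d} A) = Suc (forest_rank A)"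
proof (rule antisym)
  have finB: "finite (insert {c, d} A)" using assms by simp
  obtain I where I: "I \<subseteq> A" "forest I" "card I = forest_rank A"
    using rank_attained[OF assms(1)] by blast
  have finI: "finite I" using I assms(1) by (auto intro: finite_subset)
  have "(c, d) \<notin> reach I" using assms(2) reach_mono[OF I(1)] by blast
  then have "forest (insert {c, d} I)" "{c, d} \<notin> I"
    using I reach_edge by (metis forest_insertI, metis)
  then show "Suc (forest_rank A) \<le> forest_rank (insert {c, d} A)"
    using card_le_rank[OF finB, of "insert {c, d} I"] I finI by auto
  obtain J where J: "J \<subseteq> insert {c, d} A" "forest J" "card J = forest_rank (insert {c, d} A)"
    using rank_attained[OF finB] by blast
  have "card (J - {{c, d}}) \<le> forest_rank A"
    using J by (intro card_le_rank assms forest_mono[OF J(2)]) auto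
  then show "forest_rank (insert {c, d} A) \<le> Suc (forest_rank A)"
    using J(3) by (cases "{c, d} \<in> J") (auto simp: card_Diff_singleton)
qed

section \<open>Adding a vertex to the complete graph\<close>

definition star :: "'v \<Rightarrow> 'v set \<Rightarrow> 'v set set" where
  "star w S = (\<lambda>v. {v, w}) ` S"

definition component :: "'v set set \<Rightarrow> 'v \<Rightarrow> 'v set" where
  "component A v = reach A `` {v}"

lemma component_eq_iff: "component A u = component A v \<longleftrightarrow> (u, v) \<in> reach A"
proof
  assume "component A u = component A v"
  moreover have "v \<in> component A v" by (simp add: component_def reach_refl)
  ultimately show "(u, v) \<in> reach A" by (auto simp: component_def)
next
  assume uv: "(u, v) \<in> reach A"
  have "(u, x) \<in> reach A \<longleftrightarrow> (v, x) \<in> reach A" for x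
    using reach_trans[OF uv] reach_trans[OF reach_sym[OF uv]] by metis
  then show "component A u = component A v" by (auto simp: component_def)
qed

lemma reach_star_iff:
  assumes "w \<notin> \<Union>A" "v \<noteq> w"
  shows "(v, w) \<in> reach (A \<union> star w S) \<longleftrightarrow> (\<exists>u\<in>S. (v, u) \<in> reach A)"
proof
  assume "\<exists>u\<in>S. (v, u) \<in> reach A"
  then obtain u where u: "u \<in> S" "(v, u) \<in> reach A" by blast
  show "(v, w) \<in> reach (A \<union> star w S)"
  proof (rule reach_trans)
    show "(v, u) \<in> reach (A \<union> star w S)" using u(2) reach_mono[of A "A \<union> star w S"] by blast
    show "(u, w) \<in> reach (A \<union> star w S)" using u(1) by (intro reach_edge) (auto simp: star_def)
  qed
next
  assume "(v, w) \<in> reach (A \<union> star w S)"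
  \<comment> \<open>The alternative \<open>v = w\<close> makes the claim inductive, since the walk
    may pass through \<open>w\<close> before it ends.\<close>
  then have "v = w \<or> (\<exists>u\<in>S. (v, u) \<in> reach A)"
    unfolding reach_def[of "A \<union> star w S"]
  proof (induction rule: converse_rtrancl_induct)
    case base
    show ?case by simp
  next
    case (step v y)
    from step.hyps(1) consider "{v, y} \<in> A" | u where "u \<in> S" "{v, y} = {u, w}"
      by (auto simp: star_def)
    then show ?case
    proof cases
      case 1
      then have "y \<noteq> w" "(v, y) \<in> reach A" using assms(1) reach_edge by auto
      then show ?thesis using step.IH reach_trans by metis
    next
      case 2
      then have "v = w \<or> v = u" by (auto simp: doubleton_eq_iff)
      then show ?thesis using \<open>u \<in> S\<close> reach_refl[of u A] by blast
    qed
  qed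
  then show "\<exists>u\<in>S. (v, u) \<in> reach A" using assms(2) by simp
qed

text \<open>Insert the star edges one at a time: the edge at \<open>v\<close> raises the rank
  exactly when the component of \<open>v\<close> has not been joined to \<open>w\<close>
  yet.\<close>

lemma rank_Un_star:
  assumes "finite A" "\<forall>e\<in>A. card e = 2" "w \<notin> \<Union>A" "finite S" "w \<notin> S"
  shows "forest_rank (A \<union> star w S) = forest_rank A + card (component A ` S)"
  using assms(4,5)
proof induction
  case empty
  show ?case by (simp add: star_def)
next
  case (insert v S)
  let ?B = "A \<union> star w S"
  have eq: "A \<union> star w (insert v S) = insert {v, w} ?B" by (auto simp: star_def)
  have fin: "finite ?B" using insert assms(1) by (simp add: star_def)
  have two: "\<forall>e\<in>insert {v, w} ?B. card e = 2"
    using insert assms(2) by (auto simp: star_def card_2_iff)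
  have iff: "(v, w) \<in> reach ?B \<longleftrightarrow> component A v \<in> component A ` S"
    using reach_star_iff[OF assms(3), of v S] insert.prems by (auto simp: image_iff component_eq_iff)
  show ?case
  proof (cases "(v, w) \<in> reach ?B")
    case True
    have "(a, b) \<in> reach ?B" if "{a, b} \<in> insert {v, w} ?B" for a b
      using that True reach_sym reach_edge by (metis doubleton_eq_iff insert_iff)
    then have "forest_rank (insert {v, w} ?B) = forest_rank ?B"
      using fin two by (intro rank_eq_of_reach) auto
    then show ?thesis using True iff insert unfolding eq by (simp add: insert_absorb)
  next
    case False
    then show ?thesis using rank_insert_unreachable[OF fin False] iff insert unfolding eq by simp
  qed
qed

section \<open>Edges and ranks of complete graphs\<close>

lemma ground_complete_graph: "ground (cycle_matroid (complete_graph n)) = edges (complete_graph n)"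
  by (simp add: cycle_matroid_def)

lemma rank_complete_graph: "rank (cycle_matroid (complete_graph n)) = (\<lambda>A. forest_rank A)"
  by (simp add: cycle_matroid_def)

lemma finite_edges_complete_graph: "finite (edges (complete_graph n))"
  by (simp add: complete_graph_def)

lemma card_edges_complete_graph: "card (edges (complete_graph n)) = n choose 2"
  by (simp add: complete_graph_def n_subsets)

lemma edges_complete_graph_Suc:
  "edges (complete_graph (Suc n)) = edges (complete_graph n) \<union> star (Suc n) {1..n}"
proof (intro equalityI subsetI)
  fix e assume "e \<in> edges (complete_graph (Suc n))"
  then obtain a b where "e = {a, b}" "a \<noteq> b" "a \<in> {1..Suc n}" "b \<in> {1..Suc n}"
    unfolding complete_graph_def by (auto simp: card_2_iff)
  then consider "e = {b, Suc n}" "b \<in> {1..n}" | "e = {a, Suc n}" "a \<in> {1..n}"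
    | "e \<subseteq> {1..n}" "card e = 2"
    by (cases "a = Suc n"; cases "b = Suc n") (auto simp: insert_commute)
  then show "e \<in> edges (complete_graph n) \<union> star (Suc n) {1..n}"
    by cases (auto simp: complete_graph_def star_def)
next
  fix e assume "e \<in> edges (complete_graph n) \<union> star (Suc n) {1..n}"
  then consider "e \<subseteq> {1..n}" "card e = 2" | v where "e = {v, Suc n}" "v \<in> {1..n}"
    by (auto simp: complete_graph_def star_def)
  then show "e \<in> edges (complete_graph (Suc n))" by cases (auto simp: complete_graph_def)
qed

lemma edge_subset_complete_graphD:
  assumes "A \<subseteq> edges (complete_graph n)"
  shows "finite A" "\<forall>e\<in>A. card e = 2" "Suc n \<notin> \<Union>A"
proof -
  show "finite A" using assms finite_edges_complete_graph by (rule finite_subset)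
  show "\<forall>e\<in>A. card e = 2" using assms by (auto simp: complete_graph_def)
  have "\<Union>A \<subseteq> {1..n}" using assms by (auto simp: complete_graph_def)
  then show "Suc n \<notin> \<Union>A" by auto
qed

text \<open>The full star connects all vertices through the new one, so together with
  \<open>A\<close> it has full rank. Compared with \<open>rank_Un_star\<close>, this makes the
  corank of \<open>A\<close> with a partial star the number of components of \<open>A\<close> that
  the star misses.\<close>

lemma rank_edges_complete_graph_Suc:
  assumes "A \<subseteq> edges (complete_graph n)"
  shows "forest_rank (edges (complete_graph (Suc n))) = forest_rank A + card (component A ` {1..n})"
proof -
  let ?B = "A \<union> star (Suc n) {1..n}"
  have "(u, v) \<in> reach ?B" if "{u, v} \<in> edges (complete_graph (Suc n))" for u v
  proof -
    have w: "(a, Suc n) \<in> reach ?B" if "a \<in> {1..Suc n}" for a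
      using that by (cases "a = Suc n") (auto simp: star_def intro: reach_refl reach_edge)
    have "u \<in> {1..Suc n}" "v \<in> {1..Suc n}" using that by (auto simp: complete_graph_def)
    then show ?thesis using w reach_sym reach_trans by metis
  qed
  moreover have "?B \<subseteq> edges (complete_graph (Suc n))"
    using assms by (auto simp: edges_complete_graph_Suc)
  ultimately have "forest_rank (edges (complete_graph (Suc n))) = forest_rank ?B"
    using edge_subset_complete_graphD(1,2)[OF order_refl] by (intro rank_eq_of_reach) auto
  also have "\<dots> = forest_rank A + card (component A ` {1..n})"
    using edge_subset_complete_graphD[OF assms] by (intro rank_Un_star) auto
  finally show ?thesis .
qed

lemma component_empty: "component {} v = {v}"
  by (auto simp: component_def reach_def)

lemma forest_rank_empty: "forest_rank {} = 0"
  using rank_attained[of "{}"] by auto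

lemma rank_complete_graph_Suc: "forest_rank (edges (complete_graph (Suc n))) = n"
proof -
  have "card (component {} ` {1..n}) = n"
    by (simp add: component_empty[abs_def] card_image)
  then show ?thesis using rank_edges_complete_graph_Suc[of "{}" n] forest_rank_empty by simp
qed

text \<open>A component with k vertices contributes (x - 1) + (2^k - 1): weight x - 1 if the new
  vertex has no neighbour in it, and weight 1 for each nonempty set of neighbours.\<close>

definition component_prod :: "nat \<Rightarrow> 'a::comm_ring_1 \<Rightarrow> nat set set \<Rightarrow> 'a" where
  "component_prod n x A =
    (\<Prod>b\<in>component A ` {1..n}. x - 2 + 2 ^ card {v \<in> {1..n}. component A v = b})"

lemma tutte_complete_graph_Suc_2:
  "tutte (cycle_matroid (complete_graph (Suc n))) x 2
    = (\<Sum>A\<in>Pow (edges (complete_graph n)). component_prod n x A)"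
proof -
  let ?E = "edges (complete_graph n)" and ?R = "forest_rank (edges (complete_graph (Suc n)))"
  have disj: "?E \<inter> star (Suc n) {1..n} = {}"
    by (auto simp: complete_graph_def star_def)
  \<comment> \<open>Subsets of the star correspond bijectively to sets S of neighbours of the new
    vertex.\<close>
  have Pow_star: "Pow (star (Suc n) {1..n}) = star (Suc n) ` Pow {1..n}"
    unfolding star_def by (rule image_Pow_surj[OF refl, symmetric])
  have inj: "inj_on (star (Suc n)) (Pow {1..n})"
    unfolding star_def by (rule inj_on_image_Pow) (auto simp: inj_on_def doubleton_eq_iff)
  \<comment> \<open>At y = 2 the nullity factor is a power of 1, so only the corank matters.\<close>
  have "tutte (cycle_matroid (complete_graph (Suc n))) x 2
    = (\<Sum>A\<in>Pow (edges (complete_graph (Suc n))). (x - 1) ^ (?R - forest_rank A))"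
    by (simp add: tutte_def ground_complete_graph rank_complete_graph)
  also have "\<dots> = (\<Sum>A\<in>Pow ?E. \<Sum>S\<in>Pow {1..n}. (x - 1) ^ (?R - forest_rank (A \<union> star (Suc n) S)))"
    by (simp only: edges_complete_graph_Suc[of n] sum_Pow_Un_disjoint[OF disj] Pow_star
        sum.reindex[OF inj] comp_def)
  also have "\<dots> = (\<Sum>A\<in>Pow ?E. component_prod n x A)"
  proof (rule sum.cong[OF refl])
    fix A assume "A \<in> Pow ?E"
    then have A: "A \<subseteq> ?E" by simp
    let ?C = "component A ` {1..n}"
    have "(\<Sum>S\<in>Pow {1..n}. (x - 1) ^ (?R - forest_rank (A \<union> star (Suc n) S)))
      = (\<Sum>S\<in>Pow {1..n}. (x - 1) ^ card (?C - component A ` S))"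
    proof (rule sum.cong[OF refl])
      fix S assume "S \<in> Pow {1..n}"
      then have S: "S \<subseteq> {1..n}" "finite S" by (auto intro: finite_subset)
      have "forest_rank (A \<union> star (Suc n) S) = forest_rank A + card (component A ` S)"
        using edge_subset_complete_graphD[OF A] S by (intro rank_Un_star) auto
      moreover have "card (?C - component A ` S) = card ?C - card (component A ` S)"
        using S by (intro card_Diff_subset) auto
      ultimately show "(x - 1) ^ (?R - forest_rank (A \<union> star (Suc n) S))
          = (x - 1) ^ card (?C - component A ` S)"
        using rank_edges_complete_graph_Suc[OF A] by simp
    qed
    \<comment> \<open>The added condition holds for every vertex; it brings the sum into the form of
      \<open>sum_Pow_power_missed_values\<close>.\<close>
    also have "\<dots> = (\<Sum>S\<in>Pow {v \<in> {1..n}. component A v \<in> ?C}. (x - 1) ^ card (?C - component A ` S))"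
      by (rule sum.cong) auto
    also have "\<dots> = component_prod n x A"
      by (subst sum_Pow_power_missed_values) (auto simp: component_prod_def algebra_simps)
    finally show "(\<Sum>S\<in>Pow {1..n}. (x - 1) ^ (?R - forest_rank (A \<union> star (Suc n) S)))
      = component_prod n x A" .
  qed
  finally show ?thesis .
qed

section \<open>Lower bounds for T(1, 2) and T(0, 2)\<close>

lemma component_prod_nonneg:
  fixes x :: int
  assumes "x \<ge> 0"
  shows "component_prod n x A \<ge> 0"
  unfolding component_prod_def
proof (rule prod_nonneg, clarify)
  fix v assume v: "v \<in> {1..n}"
  let ?F = "{u \<in> {1..n}. component A u = component A v}"
  \<comment> \<open>A component has at least one vertex, so its power of 2 is at least 2 and cancels
    the -2.\<close>
  have "card ?F > 0" using v by (subst card_gt_0_iff) auto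
  then have "(2::int) ^ 1 \<le> 2 ^ card ?F" by (intro power_increasing) auto
  then show "0 \<le> x - 2 + 2 ^ card ?F" using assms by simp
qed

text \<open>For \<open>n\<close> at least 1 these are the edge sets of the connected spanning
  subgraphs of the complete graph.\<close>

definition spanning_sets :: "nat \<Rightarrow> nat set set set" where
  "spanning_sets n = {A \<in> Pow (edges (complete_graph n)).
     forest_rank A = forest_rank (edges (complete_graph n))}"

lemma component_prod_spanning:
  assumes "A \<in> spanning_sets n" "n \<ge> 1"
  shows "component_prod n x A = x - 2 + 2 ^ n"
proof -
  obtain m where m: "n = Suc m" using assms(2) by (cases n) auto
  \<comment> \<open>The rank formula reads n = (n - 1) + number of components.\<close>
  have "card (component A ` {1..n}) = 1"
    using rank_edges_complete_graph_Suc[of A n] rank_complete_graph_Suc[of n]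
      rank_complete_graph_Suc[of m] assms(1) m by (simp add: spanning_sets_def)
  then obtain b where b: "component A ` {1..n} = {b}" by (auto simp: card_1_singleton_iff)
  then have "{v \<in> {1..n}. component A v = b} = {1..n}" by blast
  then show ?thesis by (simp only: component_prod_def b) simp
qed

lemma tutte_1_2_complete_graph:
  "tutte (cycle_matroid (complete_graph n)) 1 2 = of_nat (card (spanning_sets n))"
proof -
  let ?E = "edges (complete_graph n)"
  have fin: "finite (Pow ?E)" using finite_edges_complete_graph by simp
  have le: "forest_rank A \<le> forest_rank ?E" if "A \<subseteq> ?E" for A
    using matroid.rank_mono[OF matroid_cycle_matroid[OF finite_simple_graph_complete_graph], of A ?E n] that
    by (simp add: ground_complete_graph rank_complete_graph)
  have "tutte (cycle_matroid (complete_graph n)) 1 2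
      = (\<Sum>A\<in>Pow ?E. of_bool (forest_rank A = forest_rank ?E) :: 'a)"
    unfolding tutte_def using le
    by (intro sum.cong) (auto simp: ground_complete_graph rank_complete_graph power_0_left intro: antisym)
  also have "\<dots> = of_nat (card (Pow ?E \<inter> {A. forest_rank A = forest_rank ?E}))"
    by (rule sum_of_bool_eq[OF fin fin])
  also have "Pow ?E \<inter> {A. forest_rank A = forest_rank ?E} = spanning_sets n"
    by (auto simp: spanning_sets_def)
  finally show ?thesis .
qed

lemma tutte_1_2_complete_graph_Suc:
  assumes "n \<ge> 2"
  shows "(tutte (cycle_matroid (complete_graph (Suc n))) 1 2 :: int)
    \<ge> (2 ^ n - 1) * tutte (cycle_matroid (complete_graph n)) 1 2 + 1"
proof -
  let ?E = "edges (complete_graph n)"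
  have fin: "finite (Pow ?E)" using finite_edges_complete_graph by simp
  obtain m where m: "n = Suc m" using assms by (cases n) auto
  \<comment> \<open>The empty set has rank 0, below the full rank n - 1 because n is at least 2, so
    its term comes on top of those of the connected sets.\<close>
  have notin: "{} \<notin> spanning_sets n"
    using m assms by (simp add: spanning_sets_def rank_complete_graph_Suc forest_rank_empty del: subset_empty)
  have sub: "spanning_sets n \<subseteq> Pow ?E" by (auto simp: spanning_sets_def)
  then have finS: "finite (spanning_sets n)" using fin by (rule finite_subset)
  \<comment> \<open>Every component is a singleton and contributes 1 - 2 + 2 = 1.\<close>
  have one: "component_prod n (1::int) {} = 1"
  proof -
    have "{v \<in> {1..n}. {v} = {u}} = {u}" if "u \<in> {1..n}" for u using that by auto
    then show ?thesis unfolding component_prod_def component_empty by (intro prod.neutral) auto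
  qed
  have "(\<Sum>A\<in>spanning_sets n. component_prod n (1::int) A) = (\<Sum>A\<in>spanning_sets n. 2 ^ n - 1)"
    using assms by (intro sum.cong) (simp_all add: component_prod_spanning)
  then have "(2 ^ n - 1) * tutte (cycle_matroid (complete_graph n)) 1 2 + (1::int)
      = (\<Sum>A\<in>insert {} (spanning_sets n). component_prod n 1 A)"
    using notin finS one by (simp add: tutte_1_2_complete_graph)
  also have "\<dots> \<le> (\<Sum>A\<in>Pow ?E. component_prod n 1 A)"
    using fin sub by (intro sum_mono2) (auto intro: component_prod_nonneg)
  finally show ?thesis by (simp only: tutte_complete_graph_Suc_2)
qed

lemma tutte_0_2_complete_graph_Suc:
  assumes "n \<ge> 1"
  shows "(tutte (cycle_matroid (complete_graph (Suc n))) 0 2 :: int)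
    \<ge> (2 ^ n - 2) * tutte (cycle_matroid (complete_graph n)) 1 2"
proof -
  let ?E = "edges (complete_graph n)"
  have fin: "finite (Pow ?E)" using finite_edges_complete_graph by simp
  have "(\<Sum>A\<in>spanning_sets n. component_prod n (0::int) A) = (\<Sum>A\<in>spanning_sets n. 2 ^ n - 2)"
    using assms by (intro sum.cong) (simp_all add: component_prod_spanning)
  then have "(2 ^ n - 2) * tutte (cycle_matroid (complete_graph n)) 1 2
      = (\<Sum>A\<in>spanning_sets n. component_prod n (0::int) A)"
    by (simp add: tutte_1_2_complete_graph)
  also have "\<dots> \<le> (\<Sum>A\<in>Pow ?E. component_prod n 0 A)"
    using fin by (intro sum_mono2) (auto simp: spanning_sets_def intro: component_prod_nonneg)
  finally show ?thesis by (simp only: tutte_complete_graph_Suc_2)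
qed

section \<open>Comparison with spanning trees\<close>

text \<open>At (1, 1) only sets of full rank and nullity 0 survive as powers 0^0; all of them have
  \<open>n\<close> edges.\<close>

lemma tutte_1_1_complete_graph_le:
  "(tutte (cycle_matroid (complete_graph (Suc n))) 1 1 :: int) \<le> int ((Suc n choose 2) choose n)"
proof -
  let ?M = "cycle_matroid (complete_graph (Suc n))" and ?E = "edges (complete_graph (Suc n))"
  let ?T = "{A. A \<subseteq> ?E \<and> card A = n}"
  interpret matroid ?M by (rule matroid_cycle_matroid[OF finite_simple_graph_complete_graph])
  have R: "rank ?M ?E = n" by (simp add: rank_complete_graph rank_complete_graph_Suc)
  have "tutte ?M 1 1 \<le> (\<Sum>A\<in>Pow ?E. of_bool (card A = n) :: int)"
    unfolding tutte_def ground_complete_graph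
  proof (rule sum_mono)
    fix A assume A: "A \<in> Pow ?E"
    have "rank ?M A \<le> rank ?M ?E" "rank ?M A \<le> card A"
      using A rank_mono[of A ?E] rank_le_card[of A] by (auto simp: ground_complete_graph)
    then show "(1 - 1) ^ (rank ?M ?E - rank ?M A) * (1 - 1) ^ (card A - rank ?M A)
        \<le> (of_bool (card A = n) :: int)"
      unfolding R by (auto simp: power_0_left)
  qed
  also have "\<dots> = int (card ?T)"
    using finite_edges_complete_graph[of "Suc n"]
    by (simp add: sum_of_bool_eq Int_def Collect_conj_eq[symmetric])
  also have "card ?T = (Suc n choose 2) choose n"
    by (simp add: n_subsets finite_edges_complete_graph card_edges_complete_graph)
  finally show ?thesis .
qed

section \<open>Growth of the binomial bound for spanning trees\<close>

lemma power_7_le_power_4_2: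
  assumes "n \<ge> 3"
  shows "(n + 2) * 7 ^ n \<le> 4 ^ Suc n * (2 ^ n - 1 :: nat)"
proof -
  have cases: "n = 3 \<or> n = 4 \<or> n \<ge> 5" using assms by auto
  \<comment> \<open>Moving 4^(n+1) to the left avoids the subtraction. The induction step multiplies
    the right side by 8 and needs 7(n + 3) \<le> 8(n + 2), which holds from n = 5 on; n = 3 and n =
    4 are computed.\<close>
  have "(n + 2) * 7 ^ n + 4 ^ Suc n \<le> (4 ^ Suc n * 2 ^ n :: nat)" if "n \<ge> 5"
    using that
  proof (induction n rule: dec_induct)
    case base
    show ?case by simp
  next
    case (step n)
    have "(Suc n + 2) * 7 ^ Suc n = (7 * (n + 3)) * (7 ^ n :: nat)" by (simp add: algebra_simps)
    also have "\<dots> \<le> (8 * (n + 2)) * 7 ^ n" using step.hyps by (intro mult_right_mono) auto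
    finally have "(Suc n + 2) * 7 ^ Suc n \<le> 8 * ((n + 2) * (7 ^ n :: nat))" by (simp only: mult.assoc)
    moreover have "(4::nat) ^ Suc (Suc n) \<le> 8 * 4 ^ Suc n" by simp
    moreover have "(4::nat) ^ Suc (Suc n) * 2 ^ Suc n = 8 * (4 ^ Suc n * 2 ^ n)" by simp
    ultimately show ?case using step.IH by linarith
  qed
  with cases show ?thesis by (auto simp: diff_mult_distrib2)
qed

text \<open>One step \<open>m \<rightarrow> m + 1\<close> multiplies the binomial by \<open>(m + 1) / (m + 1 - n) \<le> 7 / 4\<close>.\<close>

lemma binomial_shift_le:
  assumes "7 * n \<le> 3 * Suc m"
  shows "4 ^ j * (m + j choose n) \<le> 7 ^ j * (m choose n)"
proof (induction j)
  case 0
  show ?case by simp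
next
  case (Suc j)
  let ?k = "m + j"
  have n: "7 * n \<le> 3 * Suc ?k" using assms by simp
  have "Suc ?k * (?k choose n) = (Suc ?k - n) * (Suc ?k choose n)"
    using binomial_absorb_comp[of "Suc ?k" n] by simp
  then have "(7 * (Suc ?k - n)) * (Suc ?k choose n) = 7 * (Suc ?k * (?k choose n))" by simp
  moreover have "(4 * Suc ?k) * (Suc ?k choose n) \<le> (7 * (Suc ?k - n)) * (Suc ?k choose n)"
    using n by (intro mult_right_mono) auto
  ultimately have "Suc ?k * (4 * (Suc ?k choose n)) \<le> Suc ?k * (7 * (?k choose n))"
    by (simp only: mult_ac)
  then have "4 * (Suc ?k choose n) \<le> 7 * (?k choose n)" by (simp only: Suc_mult_le_cancel1)
  then have "4 ^ j * (4 * (Suc ?k choose n)) \<le> 7 * (4 ^ j * (?k choose n))" by simp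
  also have "\<dots> \<le> 7 * (7 ^ j * (m choose n))" using Suc.IH by simp
  finally show ?case by (simp add: mult_ac)
qed

text \<open>With N edges before and N + n + 1 after, absorption turns the new binomial into (n +
  2)/2 times C(N + n, n), and n shifts bound this by (7/4)^n C(N, n). The remaining numerical
  inequality is \<open>power_7_le_power_4_2\<close>.\<close>

lemma binomial_edges_Suc_le:
  assumes "n \<ge> 3"
  shows "(Suc (Suc n) choose 2) choose Suc n \<le> 2 * (2 ^ n - 1) * ((Suc n choose 2) choose n)"
proof -
  define N where "N = (Suc n choose 2)"
  have N: "2 * N = n * (n + 1)" unfolding N_def by (simp add: choose_two)
  have NS: "(Suc (Suc n) choose 2) = N + Suc n" unfolding N_def by (simp add: numeral_2_eq_2)
  obtain k where "n = k + 3" using assms by (metis add.commute le_Suc_ex)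
  \<comment> \<open>Doubled, this is (3n - 2)(n - 3) \<ge> 0. Equality at n = 3 is the source of the
    ratio 7/4.\<close>
  then have "7 * n \<le> 3 * Suc N" using N by (simp add: algebra_simps)
  then have shift: "4 ^ n * (N + n choose n) \<le> 7 ^ n * (N choose n)" by (rule binomial_shift_le)
  have "Suc n * (2 * (N + Suc n choose Suc n)) = 2 * Suc (N + n) * (N + n choose n)"
    using Suc_times_binomial_eq[of "N + n" n] by (simp only: add_Suc_right mult_ac)
  \<comment> \<open>As 2N = n(n + 1), the factor splits and n + 1 cancels.\<close>
  also have "2 * Suc (N + n) = Suc n * (n + 2)" using N by (simp add: algebra_simps)
  finally have "Suc n * (2 * (N + Suc n choose Suc n)) = Suc n * ((n + 2) * (N + n choose n))"
    by (simp only: mult_ac)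
  then have "2 * (N + Suc n choose Suc n) = (n + 2) * (N + n choose n)"
    by (simp only: Suc_mult_cancel1)
  then have "4 ^ n * (2 * (N + Suc n choose Suc n)) = 4 ^ n * ((n + 2) * (N + n choose n))"
    by (rule arg_cong)
  then have "2 * 4 ^ n * (N + Suc n choose Suc n) = (n + 2) * (4 ^ n * (N + n choose n))"
    by (simp only: mult_ac)
  also have "\<dots> \<le> (n + 2) * (7 ^ n * (N choose n))" using shift by (intro mult_left_mono) auto
  also have "\<dots> \<le> 4 ^ Suc n * (2 ^ n - 1) * (N choose n)"
    using mult_right_mono[OF power_7_le_power_4_2[OF assms], of "N choose n"] by (simp add: mult_ac)
  also have "\<dots> = 2 * 4 ^ n * (2 * (2 ^ n - 1) * (N choose n))" by simp
  finally show ?thesis unfolding NS N_def[symmetric] by simp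
qed

text \<open>Passing from n to n + 1, the binomial grows at most by 2(2^n - 1), which is the new
  prefactor 2^(n+1) - 2, while the old right side is at most the new T(1, 2).\<close>

lemma binomial_edges_le_spanning:
  assumes "n \<ge> 3"
  shows "int ((Suc n choose 2) choose n)
    \<le> (2 ^ n - 2) * tutte (cycle_matroid (complete_graph n)) 1 2"
  using assms
proof (induction n rule: dec_induct)
  case base
  have "spanning_sets 2 \<noteq> {}" by (auto simp: spanning_sets_def)
  moreover have "finite (spanning_sets 2)"
    by (rule finite_subset[of _ "Pow (edges (complete_graph 2))"])
      (auto simp: spanning_sets_def finite_edges_complete_graph)
  ultimately have "card (spanning_sets 2) > 0" by (simp add: card_gt_0_iff)
  then have "(tutte (cycle_matroid (complete_graph 2)) 1 2 :: int) \<ge> 1"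
    by (simp add: tutte_1_2_complete_graph)
  moreover have "(Suc 3 choose 2) choose 3 = 20" by (simp add: eval_nat_numeral)
  \<comment> \<open>T(1, 2) is at least 3 * 1 + 1 = 4 on three vertices, and 6 * 4 = 24 \<ge> 20.
    Without the summand 1 from the empty set, 18 would be too small.\<close>
  ultimately show ?case using tutte_1_2_complete_graph_Suc[of 2] by simp
next
  case (step n)
  let ?b = "int ((Suc n choose 2) choose n)"
  let ?c = "tutte (cycle_matroid (complete_graph n)) 1 2 :: int"
  let ?c' = "tutte (cycle_matroid (complete_graph (Suc n))) 1 2 :: int"
  have c: "?c \<ge> 0" by (simp add: tutte_1_2_complete_graph)
  have p: "(1::int) \<le> 2 ^ n" by simp
  have "int ((Suc (Suc n) choose 2) choose Suc n) \<le> int (2 * (2 ^ n - 1) * ((Suc n choose 2) choose n))"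
    using binomial_edges_Suc_le[OF step.hyps(1)] by (simp only: of_nat_le_iff)
  also have "\<dots> = 2 * (2 ^ n - 1) * ?b" by (simp add: of_nat_diff)
  \<comment> \<open>The induction hypothesis is weakened from 2^n - 2 to 2^n - 1 to meet the
    recursive bound.\<close>
  also have "\<dots> \<le> 2 * (2 ^ n - 1) * ((2 ^ n - 1) * ?c)"
    using p step.IH c by (intro mult_left_mono) (auto simp: algebra_simps)
  also have "\<dots> \<le> 2 * (2 ^ n - 1) * ?c'"
    using p tutte_1_2_complete_graph_Suc[of n] step.hyps by (intro mult_left_mono) auto
  finally show ?case by (simp add: algebra_simps)
qed

section \<open>The triangle\<close>

lemma forest_card_le_2:
  assumes "finite F" "card F \<le> 2"
  shows "forest F"
  unfolding forest_def
proof
  assume "\<exists>vs. distinct vs \<and> 3 \<le> length vs \<and> cycle_edges vs \<subseteq> F"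
  then obtain vs where vs: "distinct vs" "3 \<le> length vs" "cycle_edges vs \<subseteq> F" by blast
  \<comment> \<open>The vertex after \<open>vs ! 2\<close>: the first one again if the cycle is a
    triangle, otherwise \<open>vs ! 3\<close>.\<close>
  let ?w = "vs ! (3 mod length vs)"
  have in_F: "{vs ! i, vs ! (Suc i mod length vs)} \<in> F" if "i < length vs" for i
    using vs(3) that by (auto simp: cycle_edges_def)
  \<comment> \<open>Three consecutive edges of a cycle are distinct; for the last two this needs
    \<open>?w\<close> to differ from \<open>vs ! 1\<close>.\<close>
  let ?T = "{{vs ! 0, vs ! 1}, {vs ! 1, vs ! 2}, {vs ! 2, ?w}}"
  have sub: "?T \<subseteq> F"
  proof -
    have "Suc 0 mod length vs = 1" "Suc 1 mod length vs = 2" using vs(2) by auto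
    moreover have "0 < length vs" "1 < length vs" "2 < length vs" using vs(2) by auto
    ultimately show ?thesis using in_F[of 0] in_F[of 1] in_F[of 2] by (simp add: eval_nat_numeral)
  qed
  have index: "vs ! i = vs ! j \<longleftrightarrow> i = j" if "i < length vs" "j < length vs" for i j
    using vs(1) that by (rule nth_eq_iff_index_eq)
  have "3 mod length vs = 0 \<or> 3 mod length vs = 3 \<and> 3 < length vs"
    using vs(2) by (cases "length vs = 3") auto
  then have w: "?w \<noteq> vs ! 1" using vs(2) index[of "3 mod length vs" 1] by fastforce
  have "vs ! 0 \<noteq> vs ! 1" "vs ! 1 \<noteq> vs ! 2" "vs ! 0 \<noteq> vs ! 2"
    using vs(2) index[of 0 1] index[of 1 2] index[of 0 2] by linarith+
  with w have "card ?T = 3" by (auto simp: doubleton_eq_iff)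
  then show False using assms card_mono[OF assms(1) sub] by simp
qed

text \<open>The seven proper subsets are forests and contribute 1 each; the whole triangle has
  nullity 1 and contributes -1.\<close>

lemma tutte_2_0_complete_graph_3: "(tutte (cycle_matroid (complete_graph 3)) 2 0 :: int) = 6"
proof -
  let ?E = "edges (complete_graph 3)" and ?M = "cycle_matroid (complete_graph 3)"
  have fin: "finite ?E" by (rule finite_edges_complete_graph)
  have cE: "card ?E = 3" by (simp add: card_edges_complete_graph choose_two)
  have RE: "rank ?M ?E = 2"
    using rank_complete_graph_Suc[of 2] by (simp add: rank_complete_graph eval_nat_numeral)
  have summand: "(2 - 1) ^ (rank ?M ?E - rank ?M A) * (0 - 1) ^ (card A - rank ?M A) = (1::int)"
    if A: "A \<in> Pow ?E - {?E}" for A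
  proof -
    have "card A < 3" using psubset_card_mono[OF fin, of A] A cE by auto
    moreover have "finite A" using A fin by (auto intro: finite_subset)
    ultimately have "card A \<le> rank ?M A"
      by (auto simp: rank_complete_graph intro!: card_le_rank forest_card_le_2)
    then show ?thesis by simp
  qed
  have "tutte ?M 2 0 = - 1 + (\<Sum>A\<in>Pow ?E - {?E}.
      (2 - 1) ^ (rank ?M ?E - rank ?M A) * (0 - 1) ^ (card A - rank ?M A) :: int)"
    unfolding tutte_def ground_complete_graph
    using fin by (subst sum.remove[of _ ?E]) (simp_all add: RE cE)
  also have "\<dots> = - 1 + (\<Sum>A\<in>Pow ?E - {?E}. 1)" by (simp only: summand cong: sum.cong)
  also have "(\<Sum>A\<in>Pow ?E - {?E}. 1::int) = 7"
    using fin cE by (simp add: card_Diff_subset card_Pow)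
  finally show ?thesis by simp
qed

theorem theorem5p5:
  fixes n :: nat
  assumes "n \<ge> 3"
  shows "max (tutte (cycle_matroid (complete_graph n)) 2 0)
             (tutte (cycle_matroid (complete_graph n)) 0 2)
         \<ge> (tutte (cycle_matroid (complete_graph n)) 1 1 :: int)"
proof (cases "n = 3")
  case True
  have "(tutte (cycle_matroid (complete_graph 3)) 1 1 :: int) \<le> 3"
    using tutte_1_1_complete_graph_le[of 2] by (simp add: eval_nat_numeral)
  then show ?thesis using True by (simp add: tutte_2_0_complete_graph_3)
next
  case False
  \<comment> \<open>For m \<ge> 3 the chain is T(1, 1) \<le> C(C(m + 1, 2), m) \<le> (2^m - 2) c_m
    \<le> T(0, 2), where c_m is T(1, 2) on m vertices.\<close>
  then obtain m where m: "n = Suc m" "m \<ge> 3" using assms by (cases n) auto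
  then show ?thesis
    using tutte_1_1_complete_graph_le[of m] binomial_edges_le_spanning[of m]
      tutte_0_2_complete_graph_Suc[of m] by simp
qed

end
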